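(* Suppose $p(a,x)\in\mathbb R\langle a,x\rangle$ is a symmetric polynomial, $A\in\mathbb S_n(\mathbb R^g)$, and $\mathcal U$ is an open convex set in $\mathbb S_n(\mathbb R^g)$. If $p(A,X)$ is convex for $X\in\mathcal U$, i.e. for the given $A$ and each $X,Y\in\mathcal U$ and $0<t<1$, $$p(A,tX+(1-t)Y)\preceq tp(A,X)+(1-t)p(A,Y),$$ then for each $X\in\mathcal U$ and $H\in\mathbb S_n(\mathbb R^g)$, $$\frac{\partial^2}{\partial x^2}p(A,X)[H]\succeq 0.$$
   Context: Fix a positive integer $g$. $\mathbb R\langle a,x\rangle$ denotes the polynomials with real coefficients in the non-commuting variables $a=(a_1,\dots,a_g)$, $x=(x_1,\dots,x_g)$. The involution ${}^T$ on $\mathbb R\langle a,x\rangle$ is linear, reverses the order of words, and fixes each variable; $p$ is symmetric if $p^T=p$. $\mathbb S_n(\mathbb R^g)$ is the set of $g$-tuples of real symmetric $n\times n$ matrices, and polynomials are evaluated at such tuples by substitution. $P\succeq 0$ means $P$ is symmetric positive semidefinite; $P\preceq Q$ means $Q-P\succeq0$. The partial Hessian $\frac{\partial^2}{\partial x^2}p(a,x)[h]$ of $p$ with respect to $x$ in the direction $h=(h_1,\dots,h_g)$ (additional non-commuting symmetric variables) is the formal second derivative at $t=0$ of the polynomial in $t$, $t\mapsto p(a,x+th)$. It is a polynomial in the $3g$ variables $(a,x,h)$, homogeneous of degree two in $h$, and $\frac{\partial^2}{\partial x^2}p(A,X)[H]$ is its evaluation at $(A,X,H)$. *)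

theory Defs
  imports "HOL-Analysis.Analysis" "HOL-Library.Poly_Mapping"
    "HOL-Computational_Algebra.Polynomial"
begin

datatype 'v nc_word = Word (letters: "'v list")

instantiation nc_word :: (type) monoid_add
begin

definition zero_nc_word :: "'a nc_word" where
  "0 = Word []"

definition plus_nc_word :: "'a nc_word \<Rightarrow> 'a nc_word \<Rightarrow> 'a nc_word" where
  "u + v = Word (letters u @ letters v)"

instance
  by standard (simp_all add: zero_nc_word_def plus_nc_word_def)

end

text \<open>
  Words in the letters \<^typ>\<open>'v\<close> form a (non-commutative) monoid under concatenation. Writing
  it additively makes \<^typ>\<open>'v nc_word \<Rightarrow>\<^sub>0 'c\<close>, with the convolution product of
  \<^theory>\<open>HOL-Library.Poly_Mapping\<close>, the free algebra on \<^typ>\<open>'v\<close> over \<^typ>\<open>'c\<close>.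
\<close>

type_synonym ('v, 'c) ncpoly = "'v nc_word \<Rightarrow>\<^sub>0 'c"

definition nc_const :: "'c::zero \<Rightarrow> ('v, 'c) ncpoly" where
  "nc_const c = Poly_Mapping.single 0 c"

definition nc_var :: "'v \<Rightarrow> ('v, 'c::zero_neq_one) ncpoly" where
  "nc_var v = Poly_Mapping.single (Word [v]) 1"

definition nc_transpose :: "('v, 'c::comm_monoid_add) ncpoly \<Rightarrow> ('v, 'c) ncpoly" where
  "nc_transpose p =
     (\<Sum>w\<in>Poly_Mapping.keys p. Poly_Mapping.single (Word (rev (letters w))) (Poly_Mapping.lookup p w))"

text \<open>
  Evaluation at square matrices. The product \<open>**\<close> and the unit \<^term>\<open>mat 1\<close> are used because
  \<open>*\<close> and \<open>1\<close> act componentwise on this type.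
\<close>

definition eval_word :: "('v \<Rightarrow> real^'n^'n) \<Rightarrow> 'v nc_word \<Rightarrow> real^'n^'n" where
  "eval_word M w = foldr (\<lambda>v Q. M v ** Q) (letters w) (mat 1)"

definition nc_eval :: "('v \<Rightarrow> real^'n^'n) \<Rightarrow> ('v, real) ncpoly \<Rightarrow> real^'n^'n" where
  "nc_eval M p = (\<Sum>w\<in>Poly_Mapping.keys p. Poly_Mapping.lookup p w *\<^sub>R eval_word M w)"

text \<open>
  The variables \<open>(a,x)\<close> and \<open>(a,x,h)\<close>; the finite type \<^typ>\<open>'g\<close> indexes the entries of each tuple.
\<close>

datatype 'g ax_var = a_var 'g | x_var 'g

datatype 'g axh_var = A_var 'g | X_var 'g | H_var 'g

definition eval_ax ::
    "('g::finite ax_var, real) ncpoly \<Rightarrow> real^'n^'n^'g \<Rightarrow> real^'n^'n^'g \<Rightarrow> real^'n^'n" where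
  "eval_ax p A X = nc_eval (\<lambda>v. case v of a_var j \<Rightarrow> A $ j | x_var j \<Rightarrow> X $ j) p"

definition eval_axh ::
    "('g::finite axh_var, real) ncpoly \<Rightarrow> real^'n^'n^'g \<Rightarrow> real^'n^'n^'g \<Rightarrow> real^'n^'n^'g
      \<Rightarrow> real^'n^'n" where
  "eval_axh q A X H =
     nc_eval (\<lambda>v. case v of A_var j \<Rightarrow> A $ j | X_var j \<Rightarrow> X $ j | H_var j \<Rightarrow> H $ j) q"

text \<open>
  Since \<open>t\<close> is a scalar, \<open>p(a,x+th)\<close> is taken in the free algebra on \<open>(a,x,h)\<close> over
  \<open>\<real>[t]\<close>, i.e. with coefficients of type \<^typ>\<open>real poly\<close>, where \<open>t\<close> is \<open>[:0, 1:]\<close>.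
  Differentiating in \<open>t\<close> and setting \<open>t = 0\<close> is then done coefficient by coefficient.
\<close>

definition shift_var :: "'g ax_var \<Rightarrow> ('g axh_var, real poly) ncpoly" where
  "shift_var v = (case v of
       a_var j \<Rightarrow> nc_var (A_var j)
     | x_var j \<Rightarrow> nc_var (X_var j) + nc_const [:0, 1:] * nc_var (H_var j))"

definition shift_poly :: "('g ax_var, real) ncpoly \<Rightarrow> ('g axh_var, real poly) ncpoly" where
  "shift_poly p =
     (\<Sum>w\<in>Poly_Mapping.keys p. nc_const [:Poly_Mapping.lookup p w:] * prod_list (map shift_var (letters w)))"

definition partial_hessian :: "('g ax_var, real) ncpoly \<Rightarrow> ('g axh_var, real) ncpoly" where
  "partial_hessian p =
     Poly_Mapping.map (\<lambda>c. poly (pderiv (pderiv c)) 0) (shift_poly p)"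

definition sym_tuples :: "(real^'n^'n^'g::finite) set" where
  "sym_tuples = {X. \<forall>j. transpose (X $ j) = X $ j}"

definition psd :: "real^'n^'n \<Rightarrow> bool" where
  "psd P \<longleftrightarrow> transpose P = P \<and> (\<forall>v. 0 \<le> v \<bullet> (P *v v))"

definition loewner_le :: "real^'n^'n \<Rightarrow> real^'n^'n \<Rightarrow> bool" (infix "\<preceq>" 50) where
  "P \<preceq> Q \<longleftrightarrow> psd (Q - P)"

end

theory Submission
  imports Defs
begin

text \<open>
  Fix \<open>X \<in> U\<close> and a symmetric direction \<open>H\<close>. The point is that \<open>F t = p(A, X + t H)\<close> is a
  matrix-valued polynomial in the scalar \<open>t\<close>, and that the partial Hessian evaluated at
  \<open>(A, X, H)\<close> is its second derivative at \<open>t = 0\<close>. The first fact holds because substituting a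
  real number for \<open>t\<close> and matrices for the letters is a ring homomorphism on the free algebra
  over \<open>\<real>[t]\<close> (lemmas \<open>coeff_eval_mult\<close> and \<open>coeff_eval_shift_poly\<close>); the second, because the
  formal derivative acts coefficientwise (lemma \<open>eval_axh_partial_hessian\<close>).

  Consequently, for each linear functional \<open>L\<close> on matrices, \<open>L (F t)\<close> is an ordinary real
  polynomial whose second derivative at \<open>0\<close> is \<open>L\<close> of the Hessian (lemma
  \<open>linear_functional_along_line\<close>). Two families of functionals give the theorem. For
  \<open>L P = v \<bullet> (P *v v)\<close>, the convexity inequality at the midpoint of \<open>X + s H\<close> and \<open>X - s H\<close>
  says that \<open>L (F s) + L (F (-s)) \<ge> 2 L (F 0)\<close> for small \<open>s\<close>, and this forces the second derivative
  at \<open>0\<close> to be nonnegative. For \<open>L P = P $ i $ j - P $ j $ i\<close>, the polynomial vanishes identically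
  because \<open>p\<close> is symmetric, so the Hessian is a symmetric matrix.
\<close>

section \<open>Evaluation of noncommutative polynomials through their coefficients\<close>

text \<open>
  Keeping the coefficient map \<open>f\<close> abstract treats three evaluations at once: the plain one
  (\<open>f\<close> the identity), the one that substitutes a number for the scalar variable \<open>t\<close>, and the one
  that takes the second derivative at \<open>t = 0\<close>.
\<close>

definition coeff_eval ::
    "('c::zero \<Rightarrow> real) \<Rightarrow> ('v nc_word \<Rightarrow> 'b::real_vector) \<Rightarrow> ('v, 'c) ncpoly \<Rightarrow> 'b" where
  "coeff_eval f E q =
     (\<Sum>w\<in>Poly_Mapping.keys q. f (Poly_Mapping.lookup q w) *\<^sub>R E w)"

lemma coeff_eval_superset:
  assumes "f 0 = 0" "finite K" "Poly_Mapping.keys q \<subseteq> K"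
  shows "coeff_eval f E q = (\<Sum>w\<in>K. f (Poly_Mapping.lookup q w) *\<^sub>R E w)"
  unfolding coeff_eval_def
  by (rule sum.mono_neutral_left) (use assms in \<open>auto simp: in_keys_iff\<close>)

lemma coeff_eval_add:
  assumes "f 0 = 0" "\<And>a b. f (a + b) = f a + f b"
  shows "coeff_eval f E (q + r) = coeff_eval f E q + coeff_eval f E r"
proof -
  let ?K = "Poly_Mapping.keys q \<union> Poly_Mapping.keys r"
  have "finite ?K" "Poly_Mapping.keys (q + r) \<subseteq> ?K"
    by (auto simp: Poly_Mapping.keys_add)
  then show ?thesis
    using assms
    by (simp add: coeff_eval_superset[where K = ?K] lookup_add scaleR_left_distrib sum.distrib)
qed

lemma coeff_eval_zero: "coeff_eval f E 0 = 0"
  by (simp add: coeff_eval_def)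

lemma coeff_eval_sum:
  assumes "f 0 = 0" "\<And>a b. f (a + b) = f a + f b"
  shows "coeff_eval f E (\<Sum>i\<in>I. q i) = (\<Sum>i\<in>I. coeff_eval f E (q i))"
  by (induction I rule: infinite_finite_induct)
    (simp_all add: coeff_eval_zero coeff_eval_add[OF assms])

lemma coeff_eval_single:
  assumes "f 0 = 0"
  shows "coeff_eval f E (Poly_Mapping.single w c) = f c *\<^sub>R E w"
  using assms by (simp add: coeff_eval_def)

lemma coeff_eval_map:
  assumes "f 0 = 0" "g 0 = 0"
  shows "coeff_eval f E (Poly_Mapping.map g q) = coeff_eval (f \<circ> g) E q"
proof -
  have "Poly_Mapping.keys (Poly_Mapping.map g q) \<subseteq> Poly_Mapping.keys q"
    using assms(2) by (auto simp: in_keys_iff map.rep_eq when_def)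
  moreover have "Poly_Mapping.lookup (Poly_Mapping.map g q) w = g (Poly_Mapping.lookup q w)" for w
    using assms(2) by (simp add: map.rep_eq when_def)
  ultimately show ?thesis
    using assms coeff_eval_superset[of f "Poly_Mapping.keys q" "Poly_Mapping.map g q" E]
    by (simp add: coeff_eval_def)
qed

lemma nc_eval_eq_coeff_eval: "nc_eval M = coeff_eval (\<lambda>c. c) (eval_word M)"
  by (simp add: fun_eq_iff nc_eval_def coeff_eval_def)

lemma eval_word_zero: "eval_word M 0 = mat 1"
  by (simp add: eval_word_def zero_nc_word_def)

lemma eval_word_singleton: "eval_word M (Word [v]) = M v"
  by (simp add: eval_word_def)

lemma eval_word_add: "eval_word M (u + w) = eval_word M u ** eval_word M w"
proof -
  have "foldr (\<lambda>v. (**) (M v)) (xs @ ys) (mat 1) =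
      foldr (\<lambda>v. (**) (M v)) xs (mat 1) ** foldr (\<lambda>v. (**) (M v)) ys (mat 1)" for xs ys
    by (induction xs) (simp_all add: matrix_mul_assoc)
  then show ?thesis
    by (simp add: eval_word_def plus_nc_word_def)
qed

lemma bilinear_matrix_matrix_mult:
  "bilinear ((**) :: real^'n^'n \<Rightarrow> real^'n^'n \<Rightarrow> real^'n^'n)"
  by (auto simp: bilinear_def linear_iff vec_eq_iff matrix_matrix_mult_def sum.distrib
      sum_distrib_left algebra_simps)

text \<open>
  A ring homomorphism on coefficients extends to one on the free algebra: expanding both factors
  into monomials reduces the claim to the fact that \<^const>\<open>eval_word\<close> turns concatenation into
  the matrix product.
\<close>

lemma coeff_eval_mult:
  fixes q r :: "('v, 'c::semiring_0) ncpoly" and M :: "'v \<Rightarrow> real^'n^'n"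
  assumes f: "f 0 = 0" "\<And>a b. f (a + b) = f a + f b" "\<And>a b. f (a * b) = f a * f b"
  shows "coeff_eval f (eval_word M) (q * r) =
    coeff_eval f (eval_word M) q ** coeff_eval f (eval_word M) r"
proof -
  let ?s = "\<lambda>q w. Poly_Mapping.single w (Poly_Mapping.lookup q w)"
  let ?ev = "coeff_eval f (eval_word M)"
  have expand: "(\<Sum>w\<in>Poly_Mapping.keys q. ?s q w) = q" for q :: "('v, 'c) ncpoly"
    by (rule poly_mapping_eqI) (simp add: lookup_sum lookup_single when_def in_keys_iff)
  have "?ev (q * r) = ?ev ((\<Sum>u\<in>Poly_Mapping.keys q. ?s q u) * (\<Sum>w\<in>Poly_Mapping.keys r. ?s r w))"
    by (simp only: expand)
  also have "\<dots> = (\<Sum>u\<in>Poly_Mapping.keys q. \<Sum>w\<in>Poly_Mapping.keys r. ?ev (?s q u * ?s r w))"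
    by (simp add: sum_product coeff_eval_sum[OF f(1,2)])
  also have "\<dots> = (\<Sum>(u, w)\<in>Poly_Mapping.keys q \<times> Poly_Mapping.keys r.
      (f (Poly_Mapping.lookup q u) *\<^sub>R eval_word M u) **
      (f (Poly_Mapping.lookup r w) *\<^sub>R eval_word M w))"
    by (simp add: sum.cartesian_product mult_single coeff_eval_single f(1,3) eval_word_add mult.commute
        bilinear_lmul[OF bilinear_matrix_matrix_mult] bilinear_rmul[OF bilinear_matrix_matrix_mult])
  also have "\<dots> = ?ev q ** ?ev r"
    unfolding coeff_eval_def by (rule bilinear_sum[OF bilinear_matrix_matrix_mult, symmetric])
  finally show ?thesis .
qed

lemma transpose_eval_word:
  assumes "\<And>v. transpose (M v) = M v"
  shows "transpose (eval_word M w) = eval_word M (Word (rev (letters w)))"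
proof -
  have "transpose (eval_word M (Word xs)) = eval_word M (Word (rev xs))" for xs
  proof (induction xs)
    case Nil
    show ?case by (simp add: eval_word_def)
  next
    case (Cons x xs)
    have "Word (x # xs) = Word [x] + Word xs" "Word (rev (x # xs)) = Word (rev xs) + Word [x]"
      by (simp_all add: plus_nc_word_def)
    then show ?case
      using Cons
      by (simp only: eval_word_add matrix_transpose_mul eval_word_singleton assms)
  qed
  from this[of "letters w"] show ?thesis by simp
qed

lemma linear_transpose: "linear (transpose :: real^'n^'m \<Rightarrow> real^'m^'n)"
  by (auto simp: linear_iff transpose_def vec_eq_iff)

lemma transpose_nc_eval:
  assumes "\<And>v. transpose (M v) = M v"
  shows "transpose (nc_eval M p) = nc_eval M (nc_transpose p)"
  by (simp add: nc_transpose_def nc_eval_eq_coeff_eval coeff_eval_sum coeff_eval_single)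
    (simp add: coeff_eval_def linear_sum[OF linear_transpose] linear_scale[OF linear_transpose]
      transpose_eval_word[OF assms])

lemma transpose_eval_ax:
  assumes "nc_transpose p = p" "A \<in> sym_tuples" "X \<in> sym_tuples"
  shows "transpose (eval_ax p A X) = eval_ax p A X"
  unfolding eval_ax_def
  by (subst transpose_nc_eval) (use assms in \<open>auto simp: sym_tuples_def split: ax_var.split\<close>)

section \<open>The polynomial along a line and its second derivative\<close>

abbreviation axh_subst ::
    "real^'n^'n^'g \<Rightarrow> real^'n^'n^'g \<Rightarrow> real^'n^'n^'g \<Rightarrow> 'g::finite axh_var \<Rightarrow> real^'n^'n" where
  "axh_subst A X H \<equiv> \<lambda>v. case v of A_var j \<Rightarrow> A $ j | X_var j \<Rightarrow> X $ j | H_var j \<Rightarrow> H $ j"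

lemma coeff_eval_nc_const:
  assumes "f 0 = 0"
  shows "coeff_eval f (eval_word M) (nc_const c) = f c *\<^sub>R mat 1"
  using assms by (simp add: nc_const_def coeff_eval_single eval_word_zero)

lemma coeff_eval_nc_var:
  assumes "f 0 = 0" "f 1 = 1"
  shows "coeff_eval f (eval_word M) (nc_var v) = M v"
  using assms by (simp add: nc_var_def coeff_eval_single eval_word_singleton)

lemma scaleR_mat_1_mult: "(c *\<^sub>R mat 1) ** P = c *\<^sub>R (P :: real^'n^'n)"
  by (simp add: bilinear_lmul[OF bilinear_matrix_matrix_mult])

text \<open>
  Both sides are the image of \<open>p\<close> under algebra homomorphisms, and these agree on the letters.
\<close>

lemma coeff_eval_shift_poly:
  "coeff_eval (\<lambda>c. poly c t) (eval_word (axh_subst A X H)) (shift_poly p) =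
     eval_ax p A (X + t *\<^sub>R H)"
proof -
  let ?ev = "coeff_eval (\<lambda>c. poly c t) (eval_word (axh_subst A X H))"
  let ?M = "\<lambda>v. case v of a_var j \<Rightarrow> A $ j | x_var j \<Rightarrow> (X + t *\<^sub>R H) $ j"
  have mult: "?ev (q * r) = ?ev q ** ?ev r" for q r
    by (rule coeff_eval_mult) auto
  have var: "?ev (shift_var v) = ?M v" for v
    by (cases v) (simp_all add: shift_var_def coeff_eval_add mult coeff_eval_nc_var
        coeff_eval_nc_const scaleR_mat_1_mult)
  have one: "?ev 1 = mat 1"
    using coeff_eval_nc_const[of "\<lambda>c. poly c t" "axh_subst A X H" 1]
    by (simp add: nc_const_def)
  have "?ev (prod_list (map shift_var xs)) = foldr (\<lambda>v Q. ?M v ** Q) xs (mat 1)" for xs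
    by (induction xs) (simp_all add: one mult var)
  then show ?thesis
    by (simp add: shift_poly_def coeff_eval_sum mult coeff_eval_nc_const scaleR_mat_1_mult
        eval_ax_def nc_eval_def eval_word_def)
qed

lemma eval_axh_partial_hessian:
  "eval_axh (partial_hessian p) A X H =
     coeff_eval (\<lambda>c. poly (pderiv (pderiv c)) 0) (eval_word (axh_subst A X H)) (shift_poly p)"
  by (simp add: eval_axh_def partial_hessian_def nc_eval_eq_coeff_eval coeff_eval_map o_def)

text \<open>
  Scalarization: it reduces each statement about the Hessian matrix to one about the second
  derivative of a real polynomial.
\<close>

lemma linear_functional_along_line:
  fixes L :: "real^'n^'n \<Rightarrow> real"
  assumes "linear L"
  obtains q where "\<And>t. L (eval_ax p A (X + t *\<^sub>R H)) = poly q t"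
    and "L (eval_axh (partial_hessian p) A X H) = poly (pderiv (pderiv q)) 0"
proof
  let ?S = "shift_poly p" and ?E = "eval_word (axh_subst A X H)"
  let ?q = "\<Sum>w\<in>Poly_Mapping.keys ?S. smult (L (?E w)) (Poly_Mapping.lookup ?S w)"
  show "L (eval_ax p A (X + t *\<^sub>R H)) = poly ?q t" for t
    unfolding coeff_eval_shift_poly[symmetric]
    by (simp add: coeff_eval_def linear_sum[OF assms] linear_scale[OF assms] poly_sum mult.commute)
  show "L (eval_axh (partial_hessian p) A X H) = poly (pderiv (pderiv ?q)) 0"
    unfolding eval_axh_partial_hessian
    by (simp add: coeff_eval_def linear_sum[OF assms] linear_scale[OF assms] poly_sum mult.commute
        higher_pderiv_sum[of 1, simplified] pderiv_smult)
qed

text \<open>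
  Writing \<open>q = a + b t + t\<^sup>2 r\<close>, the symmetric second difference is \<open>s\<^sup>2 (r s + r (-s))\<close>, so
  \<open>r s + r (-s) \<ge> 0\<close> for small \<open>s \<noteq> 0\<close>, and in the limit \<open>2 r 0 \<ge> 0\<close>, which is the second
  derivative of \<open>q\<close> at \<open>0\<close>.
\<close>

lemma second_pderiv_nonneg_if_midpoint_convex:
  fixes q :: "real poly"
  assumes "\<forall>\<^sub>F s in at 0. 2 * poly q 0 \<le> poly q s + poly q (- s)"
  shows "0 \<le> poly (pderiv (pderiv q)) 0"
proof -
  obtain a b r where q: "q = pCons a (pCons b r)"
    by (metis pCons_cases)
  have "\<forall>\<^sub>F s in at 0. 0 \<le> poly r s + poly r (- s)"
    using assms eventually_neq_at_within[of 0]
  proof eventually_elim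
    case (elim s)
    then have "0 \<le> s\<^sup>2 * (poly r s + poly r (- s))"
      by (simp add: q algebra_simps power2_eq_square)
    with elim(2) show ?case
      by (simp add: zero_le_mult_iff)
  qed
  moreover have "((\<lambda>s. poly r s + poly r (- s)) \<longlongrightarrow> poly r 0 + poly r (- 0)) (at 0)"
    by (intro tendsto_intros)
  ultimately have "0 \<le> poly r 0 + poly r (- 0)"
    by (intro tendsto_lowerbound) auto
  then show ?thesis
    by (simp add: q pderiv_pCons)
qed

section \<open>Convexity and the Hessian\<close>

lemma sym_tuples_line:
  assumes "X \<in> sym_tuples" "H \<in> sym_tuples"
  shows "X + t *\<^sub>R H \<in> sym_tuples"
  using assms
  by (simp add: sym_tuples_def linear_add[OF linear_transpose] linear_scale[OF linear_transpose])

lemma eventually_line_in_openin: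
  assumes "openin (top_of_set sym_tuples) U" "X \<in> U" "H \<in> sym_tuples"
  shows "\<forall>\<^sub>F t in at 0. X + t *\<^sub>R H \<in> U"
proof -
  obtain V where V: "open V" "U = sym_tuples \<inter> V"
    using assms(1) by (auto simp: openin_open)
  have "((\<lambda>t. X + t *\<^sub>R H) \<longlongrightarrow> X + 0 *\<^sub>R H) (at 0)"
    by (intro tendsto_intros)
  then have "\<forall>\<^sub>F t in at 0. X + t *\<^sub>R H \<in> V"
    by (rule topological_tendstoD) (use assms V in auto)
  then show ?thesis
    by eventually_elim (use assms V in \<open>auto intro: sym_tuples_line\<close>)
qed

lemma linear_quadratic_form: "linear (\<lambda>P :: real^'n^'n. v \<bullet> (P *v v))"
  by (auto simp: linear_iff matrix_vector_mult_add_rdistrib inner_add_right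
      scaleR_matrix_vector_assoc[symmetric])

lemma linear_entry_difference: "linear (\<lambda>P :: real^'n^'n. P $ i $ j - P $ j $ i)"
  by (auto simp: linear_iff algebra_simps)

theorem proposition1p9:
  fixes p :: "('g::finite ax_var, real) ncpoly"
    and A :: "real^'n^'n^'g"
    and U :: "(real^'n^'n^'g) set"
  assumes "nc_transpose p = p"
    and "A \<in> sym_tuples"
    and "openin (top_of_set sym_tuples) U"
    and "convex U"
    and "\<forall>X\<in>U. \<forall>Y\<in>U. \<forall>t::real. 0 < t \<and> t < 1 \<longrightarrow>
           eval_ax p A (t *\<^sub>R X + (1 - t) *\<^sub>R Y) \<preceq>
             t *\<^sub>R eval_ax p A X + (1 - t) *\<^sub>R eval_ax p A Y"
  shows "\<forall>X\<in>U. \<forall>H\<in>sym_tuples. psd (eval_axh (partial_hessian p) A X H)"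
proof (intro ballI)
  fix X H :: "real^'n^'n^'g" assume X: "X \<in> U" and H: "H \<in> sym_tuples"
  let ?Hess = "eval_axh (partial_hessian p) A X H"
  let ?F = "\<lambda>t. eval_ax p A (X + t *\<^sub>R H)"
  have X_sym: "X \<in> sym_tuples"
    using assms(3) X openin_imp_subset by blast
  have "?Hess $ i $ j = ?Hess $ j $ i" for i j
  proof -
    obtain q where q: "\<And>t. ?F t $ i $ j - ?F t $ j $ i = poly q t"
      and q'': "?Hess $ i $ j - ?Hess $ j $ i = poly (pderiv (pderiv q)) 0"
      using linear_functional_along_line[OF linear_entry_difference, of p A X H] by blast
    have "transpose (?F t) = ?F t" for t
      by (intro transpose_eval_ax assms sym_tuples_line X_sym H)
    then have "poly q t = 0" for t
      unfolding q[symmetric] by (simp add: transpose_def vec_eq_iff)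
    then have "q = 0"
      using poly_all_0_iff_0 by blast
    with q'' show ?thesis by simp
  qed
  then have "transpose ?Hess = ?Hess"
    by (simp add: transpose_def vec_eq_iff)
  moreover have "0 \<le> v \<bullet> (?Hess *v v)" for v
  proof -
    obtain q where q: "\<And>t. v \<bullet> (?F t *v v) = poly q t"
      and q'': "v \<bullet> (?Hess *v v) = poly (pderiv (pderiv q)) 0"
      using linear_functional_along_line[OF linear_quadratic_form, of v p A X H] by blast
    have "- H \<in> sym_tuples"
      using H by (simp add: sym_tuples_def linear_neg[OF linear_transpose])
    then have "\<forall>\<^sub>F s in at 0. X + s *\<^sub>R H \<in> U \<and> X + s *\<^sub>R (- H) \<in> U"
      by (intro eventually_conj eventually_line_in_openin assms X H)
    then have "\<forall>\<^sub>F s in at 0. 2 * poly q 0 \<le> poly q s + poly q (- s)"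
    proof eventually_elim
      case (elim s)
      have mid: "(1/2) *\<^sub>R (X + s *\<^sub>R H) + (1 - 1/2) *\<^sub>R (X + s *\<^sub>R (- H)) = X + 0 *\<^sub>R H"
        by (simp add: algebra_simps flip: scaleR_left_distrib)
      have "eval_ax p A ((1/2) *\<^sub>R (X + s *\<^sub>R H) + (1 - 1/2) *\<^sub>R (X + s *\<^sub>R (- H))) \<preceq>
          (1/2) *\<^sub>R ?F s + (1 - 1/2) *\<^sub>R eval_ax p A (X + s *\<^sub>R (- H))"
        using elim by (intro assms(5)[rule_format]) auto
      then have "0 \<le> v \<bullet> (((1/2) *\<^sub>R ?F s + (1/2) *\<^sub>R ?F (- s) - ?F 0) *v v)"
        unfolding mid by (simp add: loewner_le_def psd_def)
      also have "\<dots> = (1/2) * poly q s + (1/2) * poly q (- s) - poly q 0"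
        unfolding q[symmetric]
        by (simp only: linear_add[OF linear_quadratic_form] linear_diff[OF linear_quadratic_form]
            linear_scale[OF linear_quadratic_form] real_scaleR_def)
      finally show ?case by simp
    qed
    then show ?thesis
      unfolding q'' by (rule second_pderiv_nonneg_if_midpoint_convex)
  qed
  ultimately show "psd ?Hess"
    by (simp add: psd_def)
qed

end
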